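(* Let $U=\begin{pmatrix} a & b\\ c & d\end{pmatrix}$ be a $2\times 2$ unitary matrix with $abcd\neq 0$, let $\triangle=\det U=ad-bc$, and let $P=\begin{pmatrix} a & b\\ 0&0\end{pmatrix}$, $Q=\begin{pmatrix} 0&0\\ c & d\end{pmatrix}$, $R=\begin{pmatrix} c & d\\ 0&0\end{pmatrix}$, $S=\begin{pmatrix} 0&0\\ a & b\end{pmatrix}$. For integers $l,m\ge 0$ with $l+m=n\ge 1$, let $\Xi(l,m)$ denote the sum of all products $M_1M_2\cdots M_n$ with each $M_j\in\{P,Q\}$, in which exactly $l$ factors equal $P$ and exactly $m$ factors equal $Q$ (one term for each such word). Then: (i) if $\min\{l,m\}\ge 1$, $$\Xi(l,m)=a^l\,\overline{a}^{\,m}\,\triangle^m\sum_{\gamma=1}^{\min\{l,m\}}\left(-\frac{|b|^2}{|a|^2}\right)^{\gamma}\binom{l-1}{\gamma-1}\binom{m-1}{\gamma-1}\left[\frac{l-\gamma}{a\gamma}P+\frac{m-\gamma}{\triangle\,\overline{a}\,\gamma}Q-\frac{1}{\triangle\,\overline{b}}R+\frac{1}{b}S\right];$$ (ii) if $l=n\ge 1$ and $m=0$, then $\Xi(l,0)=a^{l-1}P$; (iii) if $l=0$ and $m=n\ge 1$, then $\Xi(0,m)=\triangle^{m-1}\overline{a}^{\,m-1}Q$.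
   Context: $\overline{z}$ denotes the complex conjugate of $z\in\mathbf{C}$. Unitarity of $U$ gives $|a|^2+|b|^2=|c|^2+|d|^2=1$, $a\overline c+b\overline d=0$, $c=-\triangle\overline{b}$, $d=\triangle\overline{a}$, $|\triangle|=1$. *)

theory Defs
  imports "HOL-Analysis.Analysis"
begin

text \<open>The 2x2 complex matrix with rows (x, y) and (z, w).\<close>
definition mat2 :: "complex \<Rightarrow> complex \<Rightarrow> complex \<Rightarrow> complex \<Rightarrow> complex^2^2" where
  "mat2 x y z w = (\<chi> i j. if i = 1 then (if j = 1 then x else y) else (if j = 1 then z else w))"

text \<open>Conjugate transpose and unitarity.\<close>
definition adjoint2 :: "complex^2^2 \<Rightarrow> complex^2^2" where
  "adjoint2 M = (\<chi> i j. cnj (M $ j $ i))"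

definition unitary2 :: "complex^2^2 \<Rightarrow> bool" where
  "unitary2 M \<longleftrightarrow> adjoint2 M ** M = mat 1 \<and> M ** adjoint2 M = mat 1"

text \<open>Scalar multiple of a complex matrix.\<close>
definition cscale :: "complex \<Rightarrow> complex^2^2 \<Rightarrow> complex^2^2" where
  "cscale k M = (\<chi> i j. k * M $ i $ j)"

text \<open>Xi(l,m): sum over all words in {P,Q} of length l+m with exactly l letters P
  (True encodes P, False encodes Q) of the ordered product M_1 M_2 ... M_n.\<close>
definition Xi :: "complex^2^2 \<Rightarrow> complex^2^2 \<Rightarrow> nat \<Rightarrow> nat \<Rightarrow> complex^2^2" where
  "Xi P Q l m = (\<Sum>w\<in>{w :: bool list. length w = l + m \<and> length (filter id w) = l}.
      foldr (**) (map (\<lambda>x. if x then P else Q) w) (mat 1))"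

end

theory Submission
  imports Defs
begin

text \<open>Each of \<open>P, Q, R, S\<close> is a matrix unit times a row of \<open>U\<close>, so left multiplication by \<open>P\<close> or \<open>Q\<close>
  keeps their span: \<open>P(xP + yQ + zR + wS) = (ax + bw)P + (by + az)R\<close> and
  \<open>Q(xP + yQ + zR + wS) = (dy + cz)Q + (cx + dw)S\<close>. Hence \<open>\<Xi>(l,m)\<close> is a combination of \<open>P, Q, R, S\<close>
  whose coefficients are sums over words of products of transition weights \<open>a, b, c, d\<close>
  (for \<open>PP, PQ, QP, QQ\<close>). A word with \<open>\<gamma>\<close> runs of \<open>Q\<close> starting and ending with \<open>P\<close> has weight
  \<open>a\<^sup>l d\<^sup>m t\<^sup>\<gamma> / a\<close> with \<open>t = bc/(ad)\<close>, and there are \<open>C(l-1,\<gamma>) C(m-1,\<gamma>-1)\<close> of them; similarly for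
  the other three coefficients. Instead of counting words we check that these closed forms satisfy
  the recursion \<open>\<Xi>(l,m) = P \<Xi>(l-1,m) + Q \<Xi>(l,m-1)\<close>. Unitarity gives \<open>d = \<Delta> conj a\<close> and
  \<open>c = - \<Delta> conj b\<close>, whence \<open>t = -|b|\<^sup>2/|a|\<^sup>2\<close>.\<close>

lemma mat2_eq_iff: "mat2 x y z w = mat2 x' y' z' w' \<longleftrightarrow> x = x' \<and> y = y' \<and> z = z' \<and> w = w'"
  by (auto simp: mat2_def vec_eq_iff forall_2)

lemma zero_mat2: "(0::complex^2^2) = mat2 0 0 0 0"
  by (auto simp: mat2_def vec_eq_iff forall_2)

lemma mat_1_mat2: "(mat 1::complex^2^2) = mat2 1 0 0 1"
  by (auto simp: mat2_def mat_def vec_eq_iff forall_2)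

lemma mat2_add: "mat2 x y z w + mat2 x' y' z' w' = mat2 (x + x') (y + y') (z + z') (w + w')"
  by (auto simp: mat2_def vec_eq_iff forall_2)

lemma mat2_mult:
  "mat2 x y z w ** mat2 x' y' z' w' =
     mat2 (x * x' + y * z') (x * y' + y * w') (z * x' + w * z') (z * y' + w * w')"
  by (auto simp: mat2_def vec_eq_iff forall_2 matrix_matrix_mult_def UNIV_2)

lemma cscale_mat2: "cscale k (mat2 x y z w) = mat2 (k * x) (k * y) (k * z) (k * w)"
  by (auto simp: mat2_def cscale_def vec_eq_iff forall_2)

lemma sum_mat2:
  "(\<Sum>i\<in>A. mat2 (f i) (g i) (h i) (k i)) = mat2 (sum f A) (sum g A) (sum h A) (sum k A)"
  by (induction A rule: infinite_finite_induct) (auto simp: zero_mat2 mat2_add)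

lemma cscale_minus_left: "cscale (- k) M = - cscale k M"
  by (simp add: cscale_def vec_eq_iff)

lemma adjoint2_mat2: "adjoint2 (mat2 a b c d) = mat2 (cnj a) (cnj c) (cnj b) (cnj d)"
  by (auto simp: adjoint2_def mat2_def vec_eq_iff forall_2)

lemma matrix_mul_sum_right: "A ** sum f S = (\<Sum>x\<in>S. A ** f x)"
  by (induction S rule: infinite_finite_induct) (simp_all add: matrix_add_ldistrib)

definition words :: "nat \<Rightarrow> nat \<Rightarrow> bool list set" where
  "words l m = {w. length w = l + m \<and> length (filter id w) = l}"

lemma finite_words: "finite (words l m)"
  unfolding words_def by (rule finite_subset[OF _ finite_list_length[of "l + m"]]) auto

lemma Nil_in_words_iff: "[] \<in> words l m \<longleftrightarrow> l = 0 \<and> m = 0"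
  unfolding words_def by auto

lemma Cons_in_words_iff:
  "x # w \<in> words l m \<longleftrightarrow> (if x then l \<noteq> 0 \<and> w \<in> words (l - 1) m else m \<noteq> 0 \<and> w \<in> words l (m - 1))"
  unfolding words_def using length_filter_le[of id w]
  by (cases x; cases l; cases m) (auto simp del: length_filter_le)

lemma Xi_eq_sum_words:
  "Xi P Q l m = (\<Sum>w\<in>words l m. foldr (**) (map (\<lambda>x. if x then P else Q) w) (mat 1))"
  unfolding Xi_def words_def ..

lemma Xi_0_0: "Xi P Q 0 0 = mat 1"
proof -
  have "words 0 0 = {[]}"
    unfolding words_def by auto
  then show ?thesis
    unfolding Xi_eq_sum_words by simp
qed

lemma Xi_rec:
  assumes "l + m \<noteq> 0"
  shows "Xi P Q l m = (if l = 0 then 0 else P ** Xi P Q (l - 1) m)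
                    + (if m = 0 then 0 else Q ** Xi P Q l (m - 1))"
proof -
  define f where "f w = foldr (**) (map (\<lambda>x. if x then P else Q) w) (mat 1)" for w
  have f_Cons: "f (x # w) = (if x then P else Q) ** f w" for x w
    unfolding f_def by simp
  have split: "words l m = Cons True ` {w. True # w \<in> words l m} \<union> Cons False ` {w. False # w \<in> words l m}"
  proof (intro set_eqI iffI)
    fix w assume w: "w \<in> words l m"
    then obtain x w' where "w = x # w'"
      using assms by (cases w) (auto simp: Nil_in_words_iff)
    with w show "w \<in> Cons True ` {w. True # w \<in> words l m} \<union> Cons False ` {w. False # w \<in> words l m}"
      by (cases x) auto
  qed auto
  have sum_Cons: "(\<Sum>w\<in>Cons x ` A. f w) = (if x then P else Q) ** sum f A" for x A
    by (simp add: sum.reindex f_Cons matrix_mul_sum_right)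
  have "Xi P Q l m = (\<Sum>w\<in>Cons True ` {w. True # w \<in> words l m}. f w)
                   + (\<Sum>w\<in>Cons False ` {w. False # w \<in> words l m}. f w)"
    unfolding Xi_eq_sum_words f_def[symmetric]
    by (subst split, rule sum.union_disjoint) (auto intro: finite_subset[OF _ finite_words] simp: split[symmetric])
  also have "\<dots> = (if l = 0 then 0 else P ** Xi P Q (l - 1) m) + (if m = 0 then 0 else Q ** Xi P Q l (m - 1))"
    unfolding sum_Cons by (simp add: Cons_in_words_iff Xi_eq_sum_words f_def)
  finally show ?thesis .
qed

text \<open>Either the last part is \<open>1\<close>, or decreasing it by \<open>1\<close> leaves a composition with as many parts.\<close>

fun compositions :: "nat \<Rightarrow> nat \<Rightarrow> nat" where
  "compositions 0 k = (if k = 0 then 1 else 0)"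
| "compositions (Suc n) 0 = 0"
| "compositions (Suc n) (Suc k) = compositions n (Suc k) + compositions n k"

lemma compositions_Suc_Suc_eq_choose: "compositions (Suc n) (Suc k) = n choose k"
proof (induction n arbitrary: k)
  case (Suc n)
  then show ?case
    by (cases k) auto
qed simp

lemma compositions_eq_0: "n < k \<Longrightarrow> compositions n k = 0"
  by (induction n k rule: compositions.induct) auto

text \<open>Sums over the words with \<open>l\<close> letters \<open>P\<close> and \<open>m\<close> letters \<open>Q\<close> that begin with \<open>P\<close> and end with
  \<open>P\<close> (resp. \<open>Q\<close>) of \<open>t\<close> to the number of runs of \<open>Q\<close>: the run lengths form compositions of \<open>l\<close>
  and \<open>m\<close>, with \<open>k + 1\<close> (resp. \<open>k\<close>) runs of \<open>P\<close> and \<open>k\<close> runs of \<open>Q\<close>.\<close>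

definition weight_PP :: "complex \<Rightarrow> nat \<Rightarrow> nat \<Rightarrow> complex" where
  "weight_PP t l m = (\<Sum>k\<le>l + m. of_nat (compositions l (Suc k) * compositions m k) * t ^ k)"

definition weight_PQ :: "complex \<Rightarrow> nat \<Rightarrow> nat \<Rightarrow> complex" where
  "weight_PQ t l m = (\<Sum>k\<le>l + m. of_nat (compositions l k * compositions m k) * t ^ k)"

lemma weight_PQ_commute: "weight_PQ t l m = weight_PQ t m l"
  unfolding weight_PQ_def by (simp add: add.commute mult.commute)

lemma weight_PP_0_left: "weight_PP t 0 m = 0"
  unfolding weight_PP_def by simp

lemma weight_PQ_0_Suc: "weight_PQ t 0 (Suc m) = 0"
  unfolding weight_PQ_def by (intro sum.neutral) auto

lemma weight_PQ_Suc_0: "weight_PQ t (Suc l) 0 = 0"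
  using weight_PQ_0_Suc weight_PQ_commute by metis

lemma weight_PP_Suc: "weight_PP t (Suc l) m = weight_PP t l m + weight_PQ t l m"
  unfolding weight_PP_def weight_PQ_def
  by (simp add: compositions_eq_0 sum.distrib algebra_simps)

lemma weight_PQ_Suc:
  assumes "l + m \<noteq> 0"
  shows "weight_PQ t (Suc l) m = t * weight_PP t m l + weight_PQ t l m"
proof -
  have "weight_PQ t (Suc l) m = (\<Sum>k\<le>l + m. of_nat (compositions (Suc l) (Suc k) * compositions m (Suc k)) * t ^ Suc k)"
    unfolding weight_PQ_def add_Suc sum.atMost_Suc_shift by simp
  also have "\<dots> = t * (\<Sum>k\<le>l + m. of_nat (compositions m (Suc k) * compositions l k) * t ^ k)
                 + (\<Sum>k\<le>l + m. of_nat (compositions l (Suc k) * compositions m (Suc k)) * t ^ Suc k)"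
    by (simp add: sum.distrib sum_distrib_left algebra_simps)
  also have "(\<Sum>k\<le>l + m. of_nat (compositions l (Suc k) * compositions m (Suc k)) * t ^ Suc k) = weight_PQ t l m"
  proof -
    define f where "f k = of_nat (compositions l k * compositions m k) * t ^ k" for k
    have "f 0 = 0"
      using assms by (cases l; cases m) (auto simp: f_def)
    then have "(\<Sum>k\<le>l + m. f (Suc k)) = (\<Sum>k\<le>Suc (l + m). f k)"
      by (simp only: sum.atMost_Suc_shift) simp
    also have "\<dots> = weight_PQ t l m"
      by (simp add: weight_PQ_def f_def compositions_eq_0)
    finally show ?thesis
      by (simp add: f_def)
  qed
  finally show ?thesis
    by (simp add: weight_PP_def add.commute)
qed

lemma Suc_times_choose_Suc: "Suc k * (n choose Suc k) = (n - k) * (n choose k)"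
  using binomial_absorption[of k n] binomial_absorb_comp[of n k] by simp

lemma sum_atMost_eq_sum_from_1:
  fixes f :: "nat \<Rightarrow> 'a::comm_monoid_add"
  assumes "n \<le> N" "f 0 = 0" "\<And>k. n < k \<Longrightarrow> f k = 0"
  shows "(\<Sum>k\<le>N. f k) = (\<Sum>k=1..n. f k)"
  by (rule sum.mono_neutral_right) (use assms in \<open>auto simp: not_less_eq_eq\<close>)

lemma weight_PP_eq_sum_choose:
  assumes "1 \<le> l" "1 \<le> m"
  shows "weight_PP t l m = (\<Sum>\<gamma>=1..min l m. t ^ \<gamma> * of_nat ((l - 1) choose (\<gamma> - 1))
           * of_nat ((m - 1) choose (\<gamma> - 1)) * of_nat (l - \<gamma>) / of_nat \<gamma>)"
proof -
  obtain l' m' where l: "l = Suc l'" and m: "m = Suc m'"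
    using assms by (cases l; cases m) auto
  have "weight_PP t l m = (\<Sum>k=1..min l m. of_nat (compositions l (Suc k) * compositions m k) * t ^ k)"
    unfolding weight_PP_def by (rule sum_atMost_eq_sum_from_1) (auto simp: m compositions_eq_0 min_less_iff_disj)
  also have "\<dots> = (\<Sum>\<gamma>=1..min l m. t ^ \<gamma> * of_nat ((l - 1) choose (\<gamma> - 1))
           * of_nat ((m - 1) choose (\<gamma> - 1)) * of_nat (l - \<gamma>) / of_nat \<gamma>)"
  proof (intro sum.cong refl)
    fix \<gamma> assume "\<gamma> \<in> {1..min l m}"
    then obtain j where j: "\<gamma> = Suc j" by (cases \<gamma>) auto
    have "of_nat (l' choose Suc j) = (of_nat ((l' - j) * (l' choose j)) / of_nat (Suc j) :: complex)"
      using Suc_times_choose_Suc[of j l'] by (simp add: field_simps del: of_nat_Suc flip: of_nat_mult)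
    then show "of_nat (compositions l (Suc \<gamma>) * compositions m \<gamma>) * t ^ \<gamma> = t ^ \<gamma>
        * of_nat ((l - 1) choose (\<gamma> - 1)) * of_nat ((m - 1) choose (\<gamma> - 1)) * of_nat (l - \<gamma>) / of_nat \<gamma>"
      by (simp add: l m j compositions_Suc_Suc_eq_choose del: of_nat_Suc compositions.simps(3))
  qed
  finally show ?thesis .
qed

lemma weight_PQ_eq_sum_choose:
  assumes "1 \<le> l" "1 \<le> m"
  shows "weight_PQ t l m = (\<Sum>\<gamma>=1..min l m. t ^ \<gamma> * of_nat ((l - 1) choose (\<gamma> - 1))
           * of_nat ((m - 1) choose (\<gamma> - 1)))"
proof -
  obtain l' m' where l: "l = Suc l'" and m: "m = Suc m'"
    using assms by (cases l; cases m) auto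
  have "weight_PQ t l m = (\<Sum>k=1..min l m. of_nat (compositions l k * compositions m k) * t ^ k)"
    unfolding weight_PQ_def by (rule sum_atMost_eq_sum_from_1) (auto simp: m compositions_eq_0 min_less_iff_disj)
  also have "\<dots> = (\<Sum>\<gamma>=1..min l m. t ^ \<gamma> * of_nat ((l - 1) choose (\<gamma> - 1))
           * of_nat ((m - 1) choose (\<gamma> - 1)))"
  proof (intro sum.cong refl)
    fix \<gamma> assume "\<gamma> \<in> {1..min l m}"
    then obtain j where "\<gamma> = Suc j" by (cases \<gamma>) auto
    then show "of_nat (compositions l \<gamma> * compositions m \<gamma>) * t ^ \<gamma>
        = t ^ \<gamma> * of_nat ((l - 1) choose (\<gamma> - 1)) * of_nat ((m - 1) choose (\<gamma> - 1))"
      by (simp add: l m compositions_Suc_Suc_eq_choose del: compositions.simps(3))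
  qed
  finally show ?thesis .
qed

lemma weight_PP_Suc_0: "weight_PP t (Suc n) 0 = 1"
  unfolding weight_PP_def add_0_right
  by (simp only: sum.atMost_Suc_shift) (simp add: compositions_Suc_Suc_eq_choose del: compositions.simps(3))

locale nonzero_entries =
  fixes a b c d :: complex
  assumes a_nonzero: "a \<noteq> 0" and b_nonzero: "b \<noteq> 0"
    and c_nonzero: "c \<noteq> 0" and d_nonzero: "d \<noteq> 0"
begin

abbreviation "P \<equiv> mat2 a b 0 0"
abbreviation "Q \<equiv> mat2 0 0 c d"
abbreviation "R \<equiv> mat2 c d 0 0"
abbreviation "S \<equiv> mat2 0 0 a b"

definition ratio :: complex where
  "ratio = b * c / (a * d)"

definition combo :: "complex \<Rightarrow> complex \<Rightarrow> complex \<Rightarrow> complex \<Rightarrow> complex^2^2" where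
  "combo x y z w = cscale x P + cscale y Q + cscale z R + cscale w S"

lemma combo_eq_mat2: "combo x y z w = mat2 (x * a + z * c) (x * b + z * d) (y * c + w * a) (y * d + w * b)"
  unfolding combo_def by (simp add: cscale_mat2 mat2_add)

lemma combo_add: "combo x y z w + combo x' y' z' w' = combo (x + x') (y + y') (z + z') (w + w')"
  unfolding combo_eq_mat2 mat2_add mat2_eq_iff by (simp add: algebra_simps)

lemma P_mult_combo: "P ** combo x y z w = combo (a * x + b * w) 0 (b * y + a * z) 0"
  unfolding combo_eq_mat2 mat2_mult mat2_eq_iff by (simp add: algebra_simps)

lemma Q_mult_combo: "Q ** combo x y z w = combo 0 (d * y + c * z) 0 (c * x + d * w)"
  unfolding combo_eq_mat2 mat2_mult mat2_eq_iff by (simp add: algebra_simps)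

lemma cscale_sum_eq_combo:
  "cscale K (\<Sum>i\<in>A. cscale (e i) (cscale (x i) P + cscale (y i) Q + cscale (z i) R + cscale (w i) S))
   = combo (K * (\<Sum>i\<in>A. e i * x i)) (K * (\<Sum>i\<in>A. e i * y i))
       (K * (\<Sum>i\<in>A. e i * z i)) (K * (\<Sum>i\<in>A. e i * w i))"
  unfolding combo_eq_mat2
  by (simp add: cscale_mat2 mat2_add sum_mat2 mat2_eq_iff sum_distrib_left sum_distrib_right
      sum.distrib algebra_simps)

text \<open>A word with \<open>2k\<close> or \<open>2k - 1\<close> changes of letter has weight \<open>a\<^sup>l d\<^sup>m ratio\<^sup>k\<close> divided by \<open>a\<close>, \<open>d\<close>, \<open>c\<close> or \<open>b\<close>
  according as it begins and ends with \<open>PP\<close>, \<open>QQ\<close>, \<open>PQ\<close> or \<open>QP\<close>.\<close>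

definition coeff_P :: "nat \<Rightarrow> nat \<Rightarrow> complex" where
  "coeff_P l m = a ^ l * d ^ m * weight_PP ratio l m / a"

definition coeff_Q :: "nat \<Rightarrow> nat \<Rightarrow> complex" where
  "coeff_Q l m = a ^ l * d ^ m * weight_PP ratio m l / d"

definition coeff_R :: "nat \<Rightarrow> nat \<Rightarrow> complex" where
  "coeff_R l m = a ^ l * d ^ m * weight_PQ ratio l m / c"

definition coeff_S :: "nat \<Rightarrow> nat \<Rightarrow> complex" where
  "coeff_S l m = a ^ l * d ^ m * weight_PQ ratio l m / b"

lemma coeff_P_Suc_left: "coeff_P (Suc l) m = a * coeff_P l m + b * coeff_S l m"
  unfolding coeff_P_def coeff_S_def weight_PP_Suc
  using a_nonzero b_nonzero by (simp add: field_simps)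

lemma coeff_R_Suc_left: "l + m \<noteq> 0 \<Longrightarrow> coeff_R (Suc l) m = b * coeff_Q l m + a * coeff_R l m"
  unfolding coeff_R_def coeff_Q_def weight_PQ_Suc ratio_def
  using a_nonzero c_nonzero d_nonzero by (simp add: field_simps)

lemma coeff_Q_Suc_right: "coeff_Q l (Suc m) = d * coeff_Q l m + c * coeff_R l m"
  unfolding coeff_Q_def coeff_R_def weight_PP_Suc
  using c_nonzero d_nonzero by (simp add: field_simps weight_PQ_commute)

lemma coeff_S_Suc_right:
  assumes "l + m \<noteq> 0"
  shows "coeff_S l (Suc m) = c * coeff_P l m + d * coeff_S l m"
proof -
  have weight_rec: "weight_PQ ratio l (Suc m) = ratio * weight_PP ratio l m + weight_PQ ratio l m"
    using weight_PQ_Suc[of m l] assms by (simp add: weight_PQ_commute add.commute)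
  show ?thesis
    unfolding coeff_S_def coeff_P_def weight_rec unfolding ratio_def
    using a_nonzero b_nonzero d_nonzero by (simp add: field_simps)
qed

lemma coeff_P_0_left: "coeff_P 0 m = 0"
  by (simp add: coeff_P_def weight_PP_0_left)

lemma coeff_Q_0_right: "coeff_Q l 0 = 0"
  by (simp add: coeff_Q_def weight_PP_0_left)

lemma coeff_R_0_Suc: "coeff_R 0 (Suc m) = 0"
  by (simp add: coeff_R_def weight_PQ_0_Suc)

lemma coeff_S_Suc_0: "coeff_S (Suc l) 0 = 0"
  by (simp add: coeff_S_def weight_PQ_Suc_0)

theorem Xi_eq_combo:
  "l + m \<noteq> 0 \<Longrightarrow> Xi P Q l m = combo (coeff_P l m) (coeff_Q l m) (coeff_R l m) (coeff_S l m)"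
proof (induction "l + m" arbitrary: l m rule: less_induct)
  case less
  consider "l + m = 1" | l' where "l = Suc l'" "m = 0" "l' \<noteq> 0"
    | m' where "l = 0" "m = Suc m'" "m' \<noteq> 0" | l' m' where "l = Suc l'" "m = Suc m'"
    using less.prems by (cases l; cases m) auto
  then show ?case
  proof cases
    case 1
    then consider "l = 1" "m = 0" | "l = 0" "m = 1" by linarith
    then show ?thesis
      by cases (simp_all add: Xi_rec Xi_0_0 mat_1_mat2 mat2_mult combo_eq_mat2 mat2_eq_iff
          coeff_P_def coeff_Q_def coeff_R_def coeff_S_def weight_PP_Suc_0 weight_PP_0_left
          weight_PQ_0_Suc weight_PQ_Suc_0 a_nonzero d_nonzero)
  next
    case 2
    then show ?thesis
      using less.hyps[of l' 0] by (simp add: Xi_rec P_mult_combo coeff_P_Suc_left coeff_R_Suc_left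
          coeff_Q_0_right coeff_S_Suc_0)
  next
    case 3
    then show ?thesis
      using less.hyps[of 0 m'] by (simp add: Xi_rec Q_mult_combo coeff_Q_Suc_right coeff_S_Suc_right
          coeff_P_0_left coeff_R_0_Suc)
  next
    case 4
    then show ?thesis
      using less.hyps[of l' m] less.hyps[of l m'] by (simp add: Xi_rec P_mult_combo Q_mult_combo combo_add
          coeff_P_Suc_left coeff_R_Suc_left coeff_Q_Suc_right coeff_S_Suc_right)
  qed
qed

lemma Xi_no_Q: "1 \<le> l \<Longrightarrow> Xi P Q l 0 = cscale (a ^ (l - 1)) P"
  using a_nonzero
  by (cases l) (simp_all add: Xi_eq_combo combo_def coeff_P_def coeff_Q_0_right coeff_R_def coeff_S_Suc_0
      weight_PP_Suc_0 weight_PQ_Suc_0 zero_mat2 cscale_mat2 mat2_add)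

lemma Xi_no_P: "1 \<le> m \<Longrightarrow> Xi P Q 0 m = cscale (d ^ (m - 1)) Q"
  using d_nonzero
  by (cases m) (simp_all add: Xi_eq_combo combo_def coeff_P_0_left coeff_Q_def coeff_R_0_Suc coeff_S_def
      weight_PP_Suc_0 weight_PQ_0_Suc zero_mat2 cscale_mat2 mat2_add)

theorem Xi_eq_sum_choose:
  assumes "1 \<le> l" "1 \<le> m"
  shows "Xi P Q l m =
    cscale (a ^ l * d ^ m)
      (\<Sum>\<gamma>=1..min l m.
         cscale (ratio ^ \<gamma> * of_nat ((l - 1) choose (\<gamma> - 1)) * of_nat ((m - 1) choose (\<gamma> - 1)))
           (cscale (of_nat (l - \<gamma>) / (a * of_nat \<gamma>)) P + cscale (of_nat (m - \<gamma>) / (d * of_nat \<gamma>)) Q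
            + cscale (1 / c) R + cscale (1 / b) S))"
proof -
  define e where "e \<gamma> = ratio ^ \<gamma> * of_nat ((l - 1) choose (\<gamma> - 1)) * of_nat ((m - 1) choose (\<gamma> - 1))"
    for \<gamma>
  have "coeff_P l m = a ^ l * d ^ m * (\<Sum>\<gamma>=1..min l m. e \<gamma> * (of_nat (l - \<gamma>) / (a * of_nat \<gamma>)))"
    unfolding coeff_P_def weight_PP_eq_sum_choose[OF assms] e_def sum_distrib_left sum_divide_distrib
    using a_nonzero by (intro sum.cong refl) (simp add: field_simps)
  moreover have "coeff_Q l m = a ^ l * d ^ m * (\<Sum>\<gamma>=1..min l m. e \<gamma> * (of_nat (m - \<gamma>) / (d * of_nat \<gamma>)))"
    unfolding coeff_Q_def weight_PP_eq_sum_choose[OF assms(2,1)] e_def sum_distrib_left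
      sum_divide_distrib min.commute[of m]
    using d_nonzero by (intro sum.cong refl) (simp add: field_simps)
  moreover have "coeff_R l m = a ^ l * d ^ m * (\<Sum>\<gamma>=1..min l m. e \<gamma> * (1 / c))"
    unfolding coeff_R_def weight_PQ_eq_sum_choose[OF assms] e_def
    by (simp add: sum_distrib_left sum_divide_distrib)
  moreover have "coeff_S l m = a ^ l * d ^ m * (\<Sum>\<gamma>=1..min l m. e \<gamma> * (1 / b))"
    unfolding coeff_S_def weight_PQ_eq_sum_choose[OF assms] e_def
    by (simp add: sum_distrib_left sum_divide_distrib)
  ultimately show ?thesis
    using assms unfolding cscale_sum_eq_combo e_def[symmetric] by (simp add: Xi_eq_combo)
qed

end

lemma unitary2_mat2_entries:
  assumes "unitary2 (mat2 a b c d)"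
  shows "d = (a * d - b * c) * cnj a" and "c = - ((a * d - b * c) * cnj b)"
proof -
  have "mat2 a b c d ** adjoint2 (mat2 a b c d) = mat 1"
    using assms unfolding unitary2_def by simp
  then have rows: "a * cnj a + b * cnj b = 1" "a * cnj c + b * cnj d = 0"
    unfolding adjoint2_mat2 mat2_mult mat_1_mat2 mat2_eq_iff by auto
  have orth: "cnj a * c = - (cnj b * d)"
    using arg_cong[OF rows(2), of cnj] by (simp add: mult.commute eq_neg_iff_add_eq_0)
  have "(a * d - b * c) * cnj a = d * (a * cnj a + b * cnj b)"
    by (simp add: algebra_simps orth[unfolded mult.commute[of "cnj a"]])
  then show "d = (a * d - b * c) * cnj a"
    using rows(1) by simp
  have "(a * d - b * c) * cnj b = - c * (a * cnj a + b * cnj b)"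
    using orth by (simp add: algebra_simps)
  then show "c = - ((a * d - b * c) * cnj b)"
    using rows(1) by simp
qed

theorem lemma1:
  fixes a b c d :: complex
  assumes unit: "unitary2 (mat2 a b c d)"
    and nz: "a * b * c * d \<noteq> 0"
  defines "\<Delta> \<equiv> a * d - b * c"
    and "P \<equiv> mat2 a b 0 0" and "Q \<equiv> mat2 0 0 c d"
    and "R \<equiv> mat2 c d 0 0" and "S \<equiv> mat2 0 0 a b"
  shows
    "(\<forall>l m. min l m \<ge> 1 \<longrightarrow>
        Xi P Q l m =
          cscale (a ^ l * cnj a ^ m * \<Delta> ^ m)
            (\<Sum>\<gamma>=1..min l m.
               cscale ((- complex_of_real ((cmod b)\<^sup>2 / (cmod a)\<^sup>2)) ^ \<gamma>
                       * of_nat ((l - 1) choose (\<gamma> - 1)) * of_nat ((m - 1) choose (\<gamma> - 1)))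
                 (cscale (of_nat (l - \<gamma>) / (a * of_nat \<gamma>)) P
                  + cscale (of_nat (m - \<gamma>) / (\<Delta> * cnj a * of_nat \<gamma>)) Q
                  - cscale (1 / (\<Delta> * cnj b)) R
                  + cscale (1 / b) S)))
     \<and> (\<forall>l. l \<ge> 1 \<longrightarrow> Xi P Q l 0 = cscale (a ^ (l - 1)) P)
     \<and> (\<forall>m. m \<ge> 1 \<longrightarrow> Xi P Q 0 m = cscale (\<Delta> ^ (m - 1) * cnj a ^ (m - 1)) Q)"
proof -
  interpret nonzero_entries a b c d
    using nz by unfold_locales auto
  have d_eq: "\<Delta> * cnj a = d" and c_eq: "\<Delta> * cnj b = - c"
    using unitary2_mat2_entries[OF unit] unfolding \<Delta>_def by (metis, metis minus_minus)
  have power_eq: "\<Delta> ^ k * cnj a ^ k = d ^ k" for k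
    by (simp flip: d_eq power_mult_distrib)
  have scale_eq: "a ^ l * cnj a ^ m * \<Delta> ^ m = a ^ l * d ^ m" for l m
    by (simp add: mult.assoc mult.commute[of "cnj a ^ m"] power_eq)
  have ratio_eq: "- complex_of_real ((cmod b)\<^sup>2 / (cmod a)\<^sup>2) = ratio"
  proof -
    have "ratio = (b * (- (\<Delta> * cnj b))) / (a * (\<Delta> * cnj a))"
      unfolding ratio_def c_eq d_eq by simp
    also have "\<dots> = - (b * cnj b) / (a * cnj a)"
      using d_eq d_nonzero by (auto simp: field_simps)
    finally show ?thesis
      unfolding of_real_divide complex_norm_square by simp
  qed
  show ?thesis
    unfolding P_def Q_def R_def S_def scale_eq power_eq d_eq c_eq ratio_eq
      divide_minus_right cscale_minus_left diff_minus_eq_add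
    by (auto simp: Xi_eq_sum_choose Xi_no_Q Xi_no_P)
qed

end
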